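(* Let $E,F$ be Banach spaces, $U\subset E$ open, $g:U\to F$ a $C^1$ map, $y_0\in F$, and $S=g^{-1}(y_0)$. Suppose that $S$ is a generalized regular constraint but not a regular one, i.e. $y_0$ is a generalized regular value of $g$ but not a regular value of $g$. Let $f:U\to\mathbb{R}$ be a $C^1$ nonlinear functional. Then the Lagrange multiplier $L\in F^*$ in the Euler equations $$f'(x)-L\circ g'(x)=0,\qquad g(x)=y_0,$$ for a critical point $x$ of $f|_S$, is ill-posed (that is, it is not unique).
   Context: $N(\cdot)$ and $R(\cdot)$ denote the null space and range of an operator; $g'(x),f'(x)$ are Fréchet derivatives; $F^*$ is the space of bounded linear functionals on $F$. A bounded linear operator $A:E\to F$ is double split if $R(A)$ is closed and there are closed subspaces $R_+\subset E$, $N_+\subset F$ with $E=N(A)\oplus R_+$ and $F=R(A)\oplus N_+$. A point $x\in U$ is a regular point of $g$ if $g'(x)$ is surjective and $N(g'(x))$ splits $E$ (has a closed complement); $y_0\in F$ is a regular value of $g$ if $g^{-1}(y_0)$ is empty or consists only of regular points. A point $x_0\in U$ is a generalized regular point of $g$ if $g'(x_0)$ is double split, $F=R(g'(x_0))\oplus N_+$ with $N_+$ a closed subspace, and there is a neighborhood $U_0\subset U$ of $x_0$ such that $R(g'(x))\cap N_+=\{0\}$ for all $x\in U_0$; $y_0\in F$ is a generalized regular value of $g$ if $g^{-1}(y_0)$ is empty or consists only of generalized regular points. The set $S=g^{-1}(y_0)$ is called a regular (respectively generalized regular) constraint when $y_0$ is a regular (respectively generalized regular) value of $g$; in the generalized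 regular case $S$ is a $C^1$ submanifold of $U$ with $T_xS=N(g'(x))$ for $x\in S$ (known result). A critical point of $f|_S$ is a critical point of the restriction of $f$ to this submanifold. A Lagrange multiplier at a critical point $x\in S$ is an $L\in F^*$ satisfying the Euler equations.
   Formalization: Non-uniqueness is proved at each critical point x of f|_S provided S is connected or x is not a regular point of g; if S is disconnected it may contain regular points, where g'(x) is onto and the multiplier is unique, so the unrestricted claim fails. *)

theory Defs
  imports "HOL-Analysis.Analysis"
begin

text \<open>Frechet derivatives, as elements of the space of bounded linear operators.\<close>

definition fderiv :: "('a::real_normed_vector \<Rightarrow> 'b::real_normed_vector) \<Rightarrow> 'a \<Rightarrow> 'a \<Rightarrow>\<^sub>L 'b" where
  "fderiv g x = Blinfun (frechet_derivative g (at x))"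

lemma fderiv_works:
  assumes "g differentiable (at x)"
  shows "(g has_derivative blinfun_apply (fderiv g x)) (at x)"
proof -
  have D: "(g has_derivative frechet_derivative g (at x)) (at x)"
    using assms frechet_derivative_works by blast
  then have "blinfun_apply (fderiv g x) = frechet_derivative g (at x)"
    unfolding fderiv_def by (intro bounded_linear_Blinfun_apply has_derivative_bounded_linear)
  then show ?thesis using D by simp
qed

lemma fderiv_eqI:
  assumes "(g has_derivative blinfun_apply A) (at x)"
  shows "fderiv g x = A"
  by (metis assms blinfun_apply_inverse fderiv_def frechet_derivative_at)

text \<open>Continuity of the derivative is with respect to the operator norm. The definition is
  used for open \<open>U\<close> only.\<close>

definition C1_on :: "'a::real_normed_vector set \<Rightarrow> ('a \<Rightarrow> 'b::real_normed_vector) \<Rightarrow> bool" where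
  "C1_on U g \<longleftrightarrow> (\<forall>x\<in>U. g differentiable (at x)) \<and> continuous_on U (fderiv g)"

definition null_space :: "('a::real_normed_vector \<Rightarrow>\<^sub>L 'b::real_normed_vector) \<Rightarrow> 'a set" where
  "null_space A = {v. blinfun_apply A v = 0}"

definition closed_subspace :: "'a::real_normed_vector set \<Rightarrow> bool" where
  "closed_subspace M \<longleftrightarrow> subspace M \<and> closed M"

text \<open>The whole space is the direct sum of the subspaces \<open>M\<close> and \<open>N\<close>.\<close>

definition direct_sum :: "'a::real_vector set \<Rightarrow> 'a set \<Rightarrow> bool" where
  "direct_sum M N \<longleftrightarrow> {m + n | m n. m \<in> M \<and> n \<in> N} = UNIV \<and> M \<inter> N = {0}"

definition double_split :: "('a::real_normed_vector \<Rightarrow>\<^sub>L 'b::real_normed_vector) \<Rightarrow> bool" where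
  "double_split A \<longleftrightarrow>
     closed (range (blinfun_apply A)) \<and>
     (\<exists>Rp. closed_subspace Rp \<and> direct_sum (null_space A) Rp) \<and>
     (\<exists>Np. closed_subspace Np \<and> direct_sum (range (blinfun_apply A)) Np)"

definition regular_point ::
  "'a::real_normed_vector set \<Rightarrow> ('a \<Rightarrow> 'b::real_normed_vector) \<Rightarrow> 'a \<Rightarrow> bool" where
  "regular_point U g x \<longleftrightarrow>
     x \<in> U \<and> surj (blinfun_apply (fderiv g x)) \<and>
     (\<exists>M. closed_subspace M \<and> direct_sum (null_space (fderiv g x)) M)"

definition generalized_regular_point ::
  "'a::real_normed_vector set \<Rightarrow> ('a \<Rightarrow> 'b::real_normed_vector) \<Rightarrow> 'a \<Rightarrow> bool" where
  "generalized_regular_point U g x0 \<longleftrightarrow>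
     x0 \<in> U \<and> double_split (fderiv g x0) \<and>
     (\<exists>Np. closed_subspace Np \<and> direct_sum (range (blinfun_apply (fderiv g x0))) Np \<and>
        (\<exists>U0. open U0 \<and> x0 \<in> U0 \<and> U0 \<subseteq> U \<and>
           (\<forall>x\<in>U0. range (blinfun_apply (fderiv g x)) \<inter> Np = {0})))"

text \<open>The map \<open>g\<close> is considered on \<open>U\<close> only, so the constraint set is the preimage of \<open>y0\<close> in \<open>U\<close>.\<close>

definition constraint_set :: "'a set \<Rightarrow> ('a \<Rightarrow> 'b) \<Rightarrow> 'b \<Rightarrow> 'a set" where
  "constraint_set U g y0 = {x \<in> U. g x = y0}"

definition regular_value ::
  "'a::real_normed_vector set \<Rightarrow> ('a \<Rightarrow> 'b::real_normed_vector) \<Rightarrow> 'b \<Rightarrow> bool" where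
  "regular_value U g y0 \<longleftrightarrow> (\<forall>x\<in>constraint_set U g y0. regular_point U g x)"

definition generalized_regular_value ::
  "'a::real_normed_vector set \<Rightarrow> ('a \<Rightarrow> 'b::real_normed_vector) \<Rightarrow> 'b \<Rightarrow> bool" where
  "generalized_regular_value U g y0 \<longleftrightarrow>
     (\<forall>x\<in>constraint_set U g y0. generalized_regular_point U g x)"

text \<open>Tangent vectors are the velocities of \<open>C\<^sup>1\<close> curves in \<open>S\<close>. For a \<open>C\<^sup>1\<close> submanifold \<open>S\<close>
  this is the usual tangent space; nothing here presupposes that it is the null space of the
  derivative of a defining map.\<close>

definition tangent_space :: "'a::real_normed_vector set \<Rightarrow> 'a \<Rightarrow> 'a set" where
  "tangent_space S x =
     {v. \<exists>e>0. \<exists>c c'. (\<forall>t\<in>{-e<..<e}. c t \<in> S \<and> (c has_vector_derivative c' t) (at t)) \<and>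
           continuous_on {-e<..<e} c' \<and> c (0::real) = x \<and> c' 0 = v}"

text \<open>The differential at \<open>x\<close> of the restriction of \<open>f\<close> to \<open>S\<close> is the restriction of the
  derivative of \<open>f\<close> to the tangent space.\<close>

definition critical_point_on ::
  "('a::real_normed_vector \<Rightarrow> real) \<Rightarrow> 'a set \<Rightarrow> 'a \<Rightarrow> bool" where
  "critical_point_on f S x \<longleftrightarrow>
     x \<in> S \<and> (\<forall>v\<in>tangent_space S x. blinfun_apply (fderiv f x) v = 0)"

definition lagrange_multiplier ::
  "('a::real_normed_vector \<Rightarrow> real) \<Rightarrow> ('a \<Rightarrow> 'b::real_normed_vector) \<Rightarrow> 'b \<Rightarrow> 'a \<Rightarrow>
     ('b \<Rightarrow>\<^sub>L real) \<Rightarrow> bool" where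
  "lagrange_multiplier f g y0 x L \<longleftrightarrow> fderiv f x - (L o\<^sub>L fderiv g x) = 0 \<and> g x = y0"

end

theory Submission
  imports Defs
begin

text \<open>Near a generalized regular point the constraint set is the level set of a submersion onto the
  range of the derivative, so its tangent space is the whole null space. The derivative of \<open>f\<close> at a
  critical point therefore factors through \<open>A = fderiv g x\<close>: with a bounded generalized inverse \<open>T\<close>
  of \<open>A\<close>, the functional \<open>fderiv f x \<circ> T\<close> is a multiplier. At a nonregular point the range of \<open>A\<close>
  has a nonzero complement, and adding a functional that vanishes on the range gives another
  multiplier. If the constraint set is connected and contains one nonregular point, all of its
  points are nonregular, because regularity is both open and closed along it.\<close>

section \<open>Hahn-Banach separation by way of minimal sublinear functions\<close>

section \<open>Bounded functionals\<close>

text \<open>Inequalities for positive scalars suffice: applying the second one to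
  \<open>1 / c\<close> gives equality. The weak form is convenient because sublinearity is checked
  below for several pointwise infima.\<close>

definition sublinear :: "('a::real_vector \<Rightarrow> real) \<Rightarrow> bool" where
  "sublinear q \<longleftrightarrow> (\<forall>x y. q (x + y) \<le> q x + q y) \<and> (\<forall>c>0. \<forall>x. q (c *\<^sub>R x) \<le> c * q x)"

lemma sublinear_add: "sublinear q \<Longrightarrow> q (x + y) \<le> q x + q y"
  by (simp add: sublinear_def)

lemma sublinear_scale:
  assumes "sublinear q" "c > 0"
  shows "q (c *\<^sub>R x) = c * q x"
proof (rule antisym)
  show "q (c *\<^sub>R x) \<le> c * q x"
    using assms by (simp add: sublinear_def)
  have "q ((1 / c) *\<^sub>R (c *\<^sub>R x)) \<le> (1 / c) * q (c *\<^sub>R x)"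
    using assms unfolding sublinear_def by (metis zero_less_divide_1_iff)
  then show "c * q x \<le> q (c *\<^sub>R x)"
    using assms by (simp add: field_simps)
qed

lemma sublinear_0: "sublinear q \<Longrightarrow> q 0 = 0"
  using sublinear_scale[of q 2 0] by simp

lemma sublinear_minus: "sublinear q \<Longrightarrow> - q (- x) \<le> q x"
  using sublinear_add[of q x "- x"] sublinear_0[of q] by simp

text \<open>The largest sublinear minorant of \<open>q\<close> whose value at \<open>- v\<close> is at most \<open>- q v\<close>.\<close>

definition straighten :: "('a::real_vector \<Rightarrow> real) \<Rightarrow> 'a \<Rightarrow> 'a \<Rightarrow> real" where
  "straighten q v x = (INF t\<in>{0..}. q (x + t *\<^sub>R v) - t * q v)"

lemma straighten_le:
  assumes "sublinear q" "t \<ge> 0"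
  shows "straighten q v x \<le> q (x + t *\<^sub>R v) - t * q v"
  unfolding straighten_def
proof (rule cINF_lower)
  \<comment> \<open>The lower bound, which makes the infimum finite, comes from
    \<open>t v = (x + t v) + (- x)\<close> and \<open>q (t v) = t q v\<close>.\<close>
  have "- q (- x) \<le> q (x + t *\<^sub>R v) - t * q v" if "t \<ge> 0" for t
  proof -
    have "q (t *\<^sub>R v) = t * q v"
      using that sublinear_scale[OF assms(1)] sublinear_0[OF assms(1)] by (cases "t = 0") auto
    then show ?thesis
      using sublinear_add[OF assms(1), of "- x" "x + t *\<^sub>R v"] by simp
  qed
  then show "bdd_below ((\<lambda>t. q (x + t *\<^sub>R v) - t * q v) ` {0..})"
    by (intro bdd_belowI[of _ "- q (- x)"]) auto
qed (use assms in auto)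

lemma straighten_greatest:
  assumes "\<And>t. t \<ge> 0 \<Longrightarrow> b \<le> q (x + t *\<^sub>R v) - t * q v"
  shows "b \<le> straighten q v x"
  unfolding straighten_def using assms by (intro cINF_greatest) auto

lemma straighten_le_self: "sublinear q \<Longrightarrow> straighten q v x \<le> q x"
  using straighten_le[of q 0 v x] by simp

text \<open>Parameters \<open>s\<close> for \<open>x\<close> and \<open>t\<close> for
  \<open>y\<close> combine to the admissible parameter \<open>s + t\<close> for
  \<open>x + y\<close>, and scaling by \<open>c\<close> turns \<open>t\<close> into
  \<open>c t\<close>; taking infima in turn gives both inequalities.\<close>

lemma sublinear_straighten:
  assumes q: "sublinear q"
  shows "sublinear (straighten q v)"
  unfolding sublinear_def
proof (intro conjI allI impI)
  fix x y
  have "straighten q v (x + y) - (q (y + t *\<^sub>R v) - t * q v) \<le> straighten q v x" if t: "t \<ge> 0" for t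
  proof (rule straighten_greatest)
    fix s :: real
    assume "s \<ge> 0"
    then show "straighten q v (x + y) - (q (y + t *\<^sub>R v) - t * q v) \<le> q (x + s *\<^sub>R v) - s * q v"
      using straighten_le[OF q, of "s + t" v "x + y"] t
        sublinear_add[OF q, of "x + s *\<^sub>R v" "y + t *\<^sub>R v"]
      by (simp add: algebra_simps)
  qed
  then have "straighten q v (x + y) - straighten q v x \<le> straighten q v y"
    by (intro straighten_greatest) (smt (verit))
  then show "straighten q v (x + y) \<le> straighten q v x + straighten q v y"
    by simp
next
  fix c :: real and x
  assume c: "c > 0"
  have "straighten q v (c *\<^sub>R x) / c \<le> straighten q v x"
  proof (rule straighten_greatest)
    fix t :: real
    assume "t \<ge> 0"
    then show "straighten q v (c *\<^sub>R x) / c \<le> q (x + t *\<^sub>R v) - t * q v"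
      using straighten_le[OF q, of "c * t" v "c *\<^sub>R x"] c sublinear_scale[OF q c, of "x + t *\<^sub>R v"]
      by (simp add: field_simps)
  qed
  then show "straighten q v (c *\<^sub>R x) \<le> c * straighten q v x"
    using c by (simp add: field_simps)
qed

text \<open>Zorn's lemma for the reversed pointwise order on the sublinear functions below
  \<open>p\<close>. A nonempty chain is bounded by its pointwise infimum, which is finite because
  every member is at least \<open>- p (- x)\<close> at \<open>x\<close>.\<close>

lemma ex_minimal_sublinear:
  assumes p: "sublinear p"
  obtains q where "sublinear q" "q \<le> p" "\<And>r. sublinear r \<Longrightarrow> r \<le> q \<Longrightarrow> r = q"
proof -
  let ?A = "{q. sublinear q \<and> q \<le> p}"
  let ?P = "\<lambda>a b :: 'a \<Rightarrow> real. b \<le> a"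
  have "\<exists>m\<in>?A. \<forall>a\<in>?A. ?P m a \<longrightarrow> a = m"
  proof (rule predicate_Zorn)
    show "partial_order_on ?A (relation_of ?P ?A)"
      by (rule partial_order_on_relation_ofI) auto
    fix C
    assume C: "C \<in> Chains (relation_of ?P ?A)"
    show "\<exists>u\<in>?A. \<forall>a\<in>C. ?P a u"
    proof (cases "C = {}")
      case True
      then show ?thesis using p by auto
    next
      case False
      have sub: "sublinear a" "a \<le> p" if "a \<in> C" for a
        using Chains_relation_of[OF C] that by auto
      have lin: "a \<le> b \<or> b \<le> a" if "a \<in> C" "b \<in> C" for a b
        using C that unfolding Chains_def relation_of_def by auto
      define u where "u x = (INF a\<in>C. a x)" for x
      have low: "u x \<le> a x" if "a \<in> C" for a x
        unfolding u_def
      proof (rule cINF_lower[OF _ that])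
        have "- p (- x) \<le> a x" if "a \<in> C" for a
          using sublinear_minus[OF sub(1)[OF that], of x] le_funD[OF sub(2)[OF that], of "- x"] by simp
        then show "bdd_below ((\<lambda>a. a x) ` C)"
          by (intro bdd_belowI[of _ "- p (- x)"]) auto
      qed
      have great: "b \<le> u x" if "\<And>a. a \<in> C \<Longrightarrow> b \<le> a x" for b x
        unfolding u_def using False that by (intro cINF_greatest) auto
      have "sublinear u"
        unfolding sublinear_def
      proof (intro conjI allI impI)
        fix x y
        \<comment> \<open>Comparability in the chain is essential here: the smaller of
          \<open>a\<close> and \<open>b\<close> can be used for both summands, whereas the infimum
          of an arbitrary family need not be subadditive.\<close>
        have "u (x + y) \<le> a x + b y" if "a \<in> C" "b \<in> C" for a b
          using lin[OF that]
        proof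
          assume "a \<le> b"
          then show ?thesis
            using low[OF that(1), of "x + y"] sublinear_add[OF sub(1)[OF that(1)], of x y]
              le_funD[of a b y] by simp
        next
          assume "b \<le> a"
          then show ?thesis
            using low[OF that(2), of "x + y"] sublinear_add[OF sub(1)[OF that(2)], of x y]
              le_funD[of b a x] by simp
        qed
        then have "u (x + y) - b y \<le> u x" if "b \<in> C" for b
          using that by (intro great) (simp add: diff_le_eq)
        then have "u (x + y) - u x \<le> u y"
          by (intro great) (smt (verit))
        then show "u (x + y) \<le> u x + u y"
          by simp
      next
        fix c :: real and x
        assume c: "c > 0"
        have "u (c *\<^sub>R x) / c \<le> u x"
        proof (rule great)
          fix a
          assume "a \<in> C"
          then show "u (c *\<^sub>R x) / c \<le> a x"
            using low[of a "c *\<^sub>R x"] sublinear_scale[OF sub(1) c, of a x] c by (simp add: field_simps)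
        qed
        then show "u (c *\<^sub>R x) \<le> c * u x"
          using c by (simp add: field_simps)
      qed
      moreover have "u \<le> p"
        using False low sub(2) by (meson ex_in_conv le_funD le_funI order_trans)
      ultimately show ?thesis
        using low by (auto intro!: le_funI)
    qed
  qed
  then show ?thesis
    using that by (smt (verit) mem_Collect_eq order_trans)
qed

text \<open>Straightening along \<open>y\<close> cannot lower a minimal \<open>q\<close>, so
  \<open>q\<close> equals \<open>straighten q y\<close>; the parameter \<open>t = 1\<close> then
  yields the missing half of additivity.\<close>

lemma minimal_sublinear_linear:
  assumes q: "sublinear q" and min: "\<And>r. sublinear r \<Longrightarrow> r \<le> q \<Longrightarrow> r = q"
  shows "linear q"
proof -
  have add: "q (x + y) = q x + q y" for x y
  proof (rule antisym[OF sublinear_add[OF q]])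
    have "straighten q y = q"
      using q by (intro min sublinear_straighten le_funI straighten_le_self)
    then show "q x + q y \<le> q (x + y)"
      using straighten_le[OF q, of 1 y x] by simp
  qed
  have neg: "q (- x) = - q x" for x
    using add[of x "- x"] sublinear_0[OF q] by simp
  show ?thesis
  proof (rule linearI[OF add])
    fix c x
    show "q (c *\<^sub>R x) = c *\<^sub>R q x"
    proof (cases "c > 0 \<or> c = 0")
      case True
      then show ?thesis
        using sublinear_scale[OF q] sublinear_0[OF q] by auto
    next
      case False
      then show ?thesis
        using sublinear_scale[OF q, of "- c" x] neg[of "c *\<^sub>R x"] by simp
    qed
  qed
qed

text \<open>Instead of extending a functional from the line through \<open>v\<close>, the norm is
  straightened along \<open>v\<close> first. Any minimal sublinear function below the result is
  linear, dominated by the norm, and at most \<open>- norm v\<close> at \<open>- v\<close>.\<close>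

lemma ex_bounded_functional_nonzero:
  fixes v :: "'a::real_normed_vector"
  assumes "v \<noteq> 0"
  obtains \<phi> :: "'a \<Rightarrow>\<^sub>L real" where "blinfun_apply \<phi> v \<noteq> 0"
proof -
  have n: "sublinear (norm :: 'a \<Rightarrow> real)"
    by (simp add: sublinear_def norm_triangle_ineq)
  obtain q where q: "sublinear q" "q \<le> straighten norm v" "\<And>r. sublinear r \<Longrightarrow> r \<le> q \<Longrightarrow> r = q"
    using ex_minimal_sublinear[OF sublinear_straighten[OF n]] by metis
  interpret linear q
    using q by (intro minimal_sublinear_linear)
  have le: "q x \<le> norm x" for x
    using le_funD[OF q(2), of x] straighten_le_self[OF n, of v x] by simp
  have "\<bar>q x\<bar> \<le> norm x" for x
    using le[of x] le[of "- x"] neg[of x] by simp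
  then have b: "bounded_linear q"
    by (intro bounded_linear_intro[of q 1] add scale) auto
  have "q (- v) \<le> - norm v"
    using le_funD[OF q(2), of "- v"] straighten_le[OF n, of 1 v "- v"] by simp
  then have "q v \<noteq> 0"
    using assms neg[of v] by auto
  then show ?thesis
    using that[of "Blinfun q"] bounded_linear_Blinfun_apply[OF b] by simp
qed

section \<open>Open mapping theorem and bounded generalized inverses of double split
  operators\<close>

section \<open>Generalized inverses\<close>

text \<open>The Banach-Schauder argument, run inside \<open>M\<close> so that a closed subspace need
  not be made a type of its own. Baire's theorem yields approximate preimages of controlled norm,
  and a geometric series of corrections, convergent in \<open>M\<close> by closedness, turns them
  into exact ones.\<close>

lemma open_mapping_closed_subspace:
  fixes \<Phi> :: "'a::banach \<Rightarrow>\<^sub>L 'b::banach"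
  assumes M: "closed_subspace M" and onto: "blinfun_apply \<Phi> ` M = UNIV"
  shows "\<exists>K. \<forall>y. \<exists>m\<in>M. blinfun_apply \<Phi> m = y \<and> norm m \<le> K * norm y"
proof -
  have sM: "subspace M" and cM: "closed M"
    using M by (auto simp: closed_subspace_def)
  define G where "G n = closure (blinfun_apply \<Phi> ` (M \<inter> cball 0 (real n)))" for n
  have "y \<in> \<Union>(range G)" for y
  proof -
    obtain m where "m \<in> M" "y = blinfun_apply \<Phi> m"
      using onto by blast
    moreover obtain n where "norm m \<le> real n"
      using real_arch_simple by blast
    ultimately show ?thesis
      unfolding G_def using closure_subset by fastforce
  qed
  then have "\<Union>(range G) = UNIV"
    by blast
  then have "\<exists>n. interior (G n) \<noteq> {}"
    using Baire_category_alt[of "euclidean :: 'b topology" "range G"] completely_metrizable_space_euclidean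
    by (force simp: G_def)
  then obtain n y1 \<delta> where \<delta>: "\<delta> > 0" and y1: "cball y1 \<delta> \<subseteq> G n"
    by (metis all_not_in_conv mem_interior_cball)
  \<comment> \<open>A correction is a difference of two elements of norm at most \<open>n\<close>,
    rescaled by \<open>norm y / \<delta>\<close>.\<close>
  define K where "K = 2 * real n / \<delta>"
  have approx1: "\<exists>m\<in>M. norm m \<le> K * norm y \<and> norm (y - blinfun_apply \<Phi> m) < \<epsilon>" if "\<epsilon> > 0" "y \<noteq> 0" for y \<epsilon>
  proof -
    \<comment> \<open>With this scale \<open>y1 + s y\<close> still lies in the ball, so
      \<open>y\<close>, being the difference of two points of the ball divided by \<open>s\<close>,
      can be approximated.\<close>
    define s where "s = \<delta> / norm y"
    have s: "s > 0" using \<delta> that by (simp add: s_def)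
    have near: "\<exists>m. m \<in> M \<and> norm m \<le> real n \<and> dist (blinfun_apply \<Phi> m) w < s * \<epsilon> / 2"
      if "w \<in> cball y1 \<delta>" for w
    proof -
      have "w \<in> closure (blinfun_apply \<Phi> ` (M \<inter> cball 0 (real n)))"
        using y1 that by (auto simp: G_def)
      moreover have "s * \<epsilon> / 2 > 0" using s \<open>\<epsilon> > 0\<close> by simp
      ultimately obtain u where "u \<in> blinfun_apply \<Phi> ` (M \<inter> cball 0 (real n))" "dist u w < s * \<epsilon> / 2"
        unfolding closure_approachable by blast
      then show ?thesis by auto
    qed
    have "y1 + s *\<^sub>R y \<in> cball y1 \<delta>" "y1 \<in> cball y1 \<delta>"
      using \<delta> that by (simp_all add: s_def dist_norm)
    then obtain m1 m2 where m: "m1 \<in> M" "norm m1 \<le> real n" "dist (blinfun_apply \<Phi> m1) (y1 + s *\<^sub>R y) < s * \<epsilon> / 2"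
      "m2 \<in> M" "norm m2 \<le> real n" "dist (blinfun_apply \<Phi> m2) y1 < s * \<epsilon> / 2"
      using near[of "y1 + s *\<^sub>R y"] near[of y1] by blast
    have "m1 - m2 \<in> M" using m sM by (simp add: subspace_diff)
    then have "(1 / s) *\<^sub>R (m1 - m2) \<in> M" using sM by (simp add: subspace_scale)
    moreover have "norm ((1 / s) *\<^sub>R (m1 - m2)) \<le> K * norm y"
    proof -
      have "norm (m1 - m2) \<le> 2 * real n"
        using norm_triangle_ineq4[of m1 m2] m by simp
      then have "(1 / s) * norm (m1 - m2) \<le> (1 / s) * (2 * real n)"
        using s by (intro mult_left_mono) auto
      moreover have "(1 / s) * (2 * real n) = K * norm y"
        by (simp add: K_def s_def)
      ultimately show ?thesis using s by simp
    qed
    moreover have "norm (y - blinfun_apply \<Phi> ((1 / s) *\<^sub>R (m1 - m2))) < \<epsilon>"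
    proof -
      have "y - blinfun_apply \<Phi> ((1 / s) *\<^sub>R (m1 - m2))
          = (1 / s) *\<^sub>R ((y1 + s *\<^sub>R y - blinfun_apply \<Phi> m1) - (y1 - blinfun_apply \<Phi> m2))"
        using s by (simp add: blinfun.bilinear_simps algebra_simps)
      moreover have "norm ((y1 + s *\<^sub>R y - blinfun_apply \<Phi> m1) - (y1 - blinfun_apply \<Phi> m2)) < s * \<epsilon>"
        using norm_triangle_ineq4[of "y1 + s *\<^sub>R y - blinfun_apply \<Phi> m1" "y1 - blinfun_apply \<Phi> m2"] m(3,6)
        by (simp add: dist_norm norm_minus_commute)
      ultimately have "norm (y - blinfun_apply \<Phi> ((1 / s) *\<^sub>R (m1 - m2)))
          = (1 / s) * norm ((y1 + s *\<^sub>R y - blinfun_apply \<Phi> m1) - (y1 - blinfun_apply \<Phi> m2))"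
        "norm ((y1 + s *\<^sub>R y - blinfun_apply \<Phi> m1) - (y1 - blinfun_apply \<Phi> m2)) < s * \<epsilon>"
        using s by simp_all
      then show ?thesis using s by (simp only:) (simp add: divide_less_eq mult.commute)
    qed
    ultimately show ?thesis by blast
  qed
  have approx: "\<exists>m\<in>M. norm m \<le> K * norm y \<and> norm (y - blinfun_apply \<Phi> m) \<le> norm y / 2" for y
  proof (cases "y = 0")
    case True
    then show ?thesis using sM by (intro bexI[of _ 0]) (auto simp: subspace_0)
  next
    case False
    then show ?thesis using approx1[of "norm y / 2" y] by force
  qed
  then obtain \<mu> where \<mu>: "\<And>y. \<mu> y \<in> M" "\<And>y. norm (\<mu> y) \<le> K * norm y"
    "\<And>y. norm (y - blinfun_apply \<Phi> (\<mu> y)) \<le> norm y / 2"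
    by metis
  have K: "K \<ge> 0" using \<delta> by (simp add: K_def)
  show ?thesis
  proof (intro exI[of _ "2 * K"] allI)
    fix y
    \<comment> \<open>\<open>z k\<close> is the residual after \<open>k\<close> corrections. Its
      norm at least halves each time, and the corrections sum to the preimage by
      telescoping.\<close>
    define z where "z k = ((\<lambda>y. y - blinfun_apply \<Phi> (\<mu> y)) ^^ k) y" for k
    have z0: "z 0 = y" and zS: "z (Suc k) = z k - blinfun_apply \<Phi> (\<mu> (z k))" for k
      by (simp_all add: z_def)
    have zle: "norm (z k) \<le> norm y * (1 / 2) ^ k" for k
    proof (induction k)
      case (Suc k)
      then show ?case using \<mu>(3)[of "z k"] by (simp add: zS)
    qed (simp add: z0)
    have mle: "norm (\<mu> (z k)) \<le> K * norm y * (1 / 2) ^ k" for k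
      using \<mu>(2)[of "z k"] mult_left_mono[OF zle K, of k] by (simp add: mult.assoc)
    have geo: "(\<lambda>k. K * norm y * (1 / 2) ^ k) sums (K * norm y * 2)"
      using sums_mult[OF geometric_sums[of "1 / 2 :: real"], of "K * norm y"] by simp
    have sn: "summable (\<lambda>k. norm (\<mu> (z k)))"
      by (rule summable_comparison_test'[OF sums_summable[OF geo]]) (use mle in auto)
    define m where "m = (\<Sum>k. \<mu> (z k))"
    have ms: "(\<lambda>k. \<mu> (z k)) sums m"
      unfolding m_def using summable_norm_cancel[OF sn] by (rule summable_sums)
    have "m \<in> M"
    proof (rule closed_sequentially[OF cM])
      show "(\<lambda>n. \<Sum>k<n. \<mu> (z k)) \<longlonglongrightarrow> m"
        using ms by (simp add: sums_def)
      show "(\<Sum>k<n. \<mu> (z k)) \<in> M" for n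
        using sM \<mu>(1) by (simp add: subspace_sum)
    qed
    moreover have "norm m \<le> 2 * K * norm y"
    proof -
      have "norm m \<le> (\<Sum>k. norm (\<mu> (z k)))"
        unfolding m_def by (rule summable_norm[OF sn])
      also have "\<dots> \<le> (\<Sum>k. K * norm y * (1 / 2) ^ k)"
        by (rule suminf_le[OF mle sn sums_summable[OF geo]])
      also have "\<dots> = 2 * K * norm y"
        using sums_unique[OF geo] by simp
      finally show ?thesis .
    qed
    moreover have "blinfun_apply \<Phi> m = y"
    proof -
      have "(\<lambda>k. blinfun_apply \<Phi> (\<mu> (z k))) sums blinfun_apply \<Phi> m"
        using bounded_linear.sums[OF blinfun.bounded_linear_right ms] .
      moreover have "(\<lambda>k. z k - z (Suc k)) sums (z 0 - 0)"
      proof (rule telescope_sums')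
        have "(\<lambda>k. norm y * (1 / 2) ^ k) \<longlonglongrightarrow> norm y * 0"
          by (intro tendsto_mult tendsto_const LIMSEQ_power_zero) simp
        then show "z \<longlonglongrightarrow> 0"
          by (intro Lim_null_comparison[of z "\<lambda>k. norm y * (1 / 2) ^ k"]) (use zle in auto)
      qed
      ultimately show ?thesis
        by (simp add: zS z0 sums_unique2)
    qed
    ultimately show "\<exists>m\<in>M. blinfun_apply \<Phi> m = y \<and> norm m \<le> 2 * K * norm y"
      by blast
  qed
qed

text \<open>The map \<open>(r, n) \<mapsto> A r + n\<close> is a bijection from
  \<open>Rp \<times> Np\<close> onto the target space, and \<open>T\<close> is the first component
  of its inverse, bounded by the open mapping theorem. Thus \<open>T A\<close> projects onto
  \<open>Rp\<close> along the null space, and \<open>A T\<close> onto the range along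
  \<open>Np\<close>.\<close>

lemma generalized_inverse:
  fixes A :: "'a::banach \<Rightarrow>\<^sub>L 'b::banach"
  assumes Rp: "closed_subspace Rp" "direct_sum (null_space A) Rp"
    and Np: "closed_subspace Np" "direct_sum (range (blinfun_apply A)) Np"
  obtains T :: "'b \<Rightarrow>\<^sub>L 'a" where
    "\<And>x. blinfun_apply A (blinfun_apply T (blinfun_apply A x)) = blinfun_apply A x"
    "\<And>y. blinfun_apply T (blinfun_apply A (blinfun_apply T y)) = blinfun_apply T y"
    "\<And>y. blinfun_apply T y = 0 \<longleftrightarrow> y \<in> Np"
proof -
  have sR: "subspace Rp" and cR: "closed Rp" and sN: "subspace Np" and cN: "closed Np"
    using assms by (auto simp: closed_subspace_def)
  define \<Phi> where "\<Phi> = (A o\<^sub>L fst_blinfun) + snd_blinfun"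
  have \<Phi>: "blinfun_apply \<Phi> (r, n) = blinfun_apply A r + n" for r n
    by (simp add: \<Phi>_def blinfun.bilinear_simps)
  have lift: "\<exists>r\<in>Rp. blinfun_apply A r = blinfun_apply A x" for x
  proof -
    have "x \<in> {m + n | m n. m \<in> null_space A \<and> n \<in> Rp}"
      using Rp(2) by (simp add: direct_sum_def)
    then show ?thesis
      by (auto simp: null_space_def blinfun.bilinear_simps)
  qed
  have "\<exists>p\<in>Rp \<times> Np. blinfun_apply \<Phi> p = y" for y
  proof -
    have "y \<in> {m + n | m n. m \<in> range (blinfun_apply A) \<and> n \<in> Np}"
      using Np(2) by (simp add: direct_sum_def)
    then obtain x n where "y = blinfun_apply A x + n" "n \<in> Np" by auto
    with lift[of x] show ?thesis by (metis \<Phi> mem_Sigma_iff)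
  qed
  then have "blinfun_apply \<Phi> ` (Rp \<times> Np) = UNIV"
    by (metis UNIV_eq_I image_eqI)
  moreover have "closed_subspace (Rp \<times> Np)"
    using sR sN cR cN by (simp add: closed_subspace_def subspace_Times closed_Times)
  ultimately obtain K where K: "\<And>y. \<exists>p\<in>Rp \<times> Np. blinfun_apply \<Phi> p = y \<and> norm p \<le> K * norm y"
    using open_mapping_closed_subspace by metis
  have "\<exists>r n. r \<in> Rp \<and> n \<in> Np \<and> blinfun_apply A r + n = y \<and> norm r \<le> K * norm y" for y
    using K[of y] norm_fst_le by (metis \<Phi> mem_Times_iff order_trans prod.collapse)
  then obtain \<tau> \<nu> where \<tau>: "\<And>y. \<tau> y \<in> Rp" "\<And>y. \<nu> y \<in> Np" "\<And>y. blinfun_apply A (\<tau> y) + \<nu> y = y"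
    "\<And>y. norm (\<tau> y) \<le> K * norm y"
    by metis
  \<comment> \<open>The functions \<open>\<tau>\<close> and \<open>\<nu>\<close> are merely chosen,
    so linearity has to come from uniqueness of the decomposition. Both direct sums enter:
    \<open>A (r - \<tau> ?y)\<close> lies in the range and in \<open>Np\<close>, and then
    \<open>r - \<tau> ?y\<close> lies in the null space and in \<open>Rp\<close>.\<close>
  have uniq: "\<tau> (blinfun_apply A r + n) = r" if "r \<in> Rp" "n \<in> Np" for r n
  proof -
    let ?y = "blinfun_apply A r + n"
    have "blinfun_apply A (r - \<tau> ?y) = \<nu> ?y - n"
      using \<tau>(3)[of ?y] by (simp add: blinfun.bilinear_simps algebra_simps)
    moreover have "\<nu> ?y - n \<in> Np"
      using sN \<tau>(2) that by (simp add: subspace_diff)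
    ultimately have "blinfun_apply A (r - \<tau> ?y) \<in> range (blinfun_apply A) \<inter> Np"
      by (metis IntI rangeI)
    then have "r - \<tau> ?y \<in> null_space A"
      using Np(2) by (auto simp: direct_sum_def null_space_def)
    moreover have "r - \<tau> ?y \<in> Rp"
      using sR \<tau>(1) that by (simp add: subspace_diff)
    ultimately have "r - \<tau> ?y = 0"
      using Rp(2) unfolding direct_sum_def by blast
    then show ?thesis by simp
  qed
  have bl: "bounded_linear \<tau>"
  proof (rule bounded_linear_intro)
    fix x y
    have "\<tau> (blinfun_apply A (\<tau> x + \<tau> y) + (\<nu> x + \<nu> y)) = \<tau> x + \<tau> y"
      using \<tau>(1,2) sR sN by (intro uniq subspace_add)
    moreover have "blinfun_apply A (\<tau> x + \<tau> y) + (\<nu> x + \<nu> y) = x + y"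
      using \<tau>(3)[of x] \<tau>(3)[of y] by (simp add: blinfun.bilinear_simps algebra_simps)
    ultimately show "\<tau> (x + y) = \<tau> x + \<tau> y" by simp
  next
    fix c y
    have "\<tau> (blinfun_apply A (c *\<^sub>R \<tau> y) + c *\<^sub>R \<nu> y) = c *\<^sub>R \<tau> y"
      using \<tau>(1,2) sR sN by (intro uniq subspace_scale)
    moreover have "blinfun_apply A (c *\<^sub>R \<tau> y) + c *\<^sub>R \<nu> y = c *\<^sub>R y"
      using \<tau>(3)[of y] by (metis blinfun.scaleR_right scaleR_right_distrib)
    ultimately show "\<tau> (c *\<^sub>R y) = c *\<^sub>R \<tau> y" by simp
  next
    fix y
    show "norm (\<tau> y) \<le> norm y * K" using \<tau>(4)[of y] by (simp add: mult.commute)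
  qed
  have T: "blinfun_apply (Blinfun \<tau>) = \<tau>"
    by (rule bounded_linear_Blinfun_apply[OF bl])
  have tA: "\<tau> (blinfun_apply A r) = r" if "r \<in> Rp" for r
    using uniq[OF that subspace_0[OF sN]] by simp
  show ?thesis
  proof (rule that[of "Blinfun \<tau>"], unfold T)
    show "blinfun_apply A (\<tau> (blinfun_apply A x)) = blinfun_apply A x" for x
      using lift[of x] tA by metis
    show "\<tau> (blinfun_apply A (\<tau> y)) = \<tau> y" for y
      using tA \<tau>(1) by blast
    show "\<tau> y = 0 \<longleftrightarrow> y \<in> Np" for y
      using \<tau>(2,3)[of y] uniq[OF subspace_0[OF sR], of y] by (auto simp: blinfun.bilinear_simps)
  qed
qed

section \<open>Contraction principle and a C1 inverse function theorem\<close>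

section \<open>Perturbations of the identity\<close>

text \<open>Solutions of \<open>H z = y\<close> are the fixed points of \<open>z - H z + y\<close>,
  a contraction with factor 1/2; the bound \<open>r / 2\<close> on \<open>y - H x0\<close> makes it
  map the ball into itself.\<close>

lemma perturbed_identity_attains:
  fixes H :: "'a::banach \<Rightarrow> 'a"
  assumes lip: "\<And>x z. x \<in> cball x0 r \<Longrightarrow> z \<in> cball x0 r \<Longrightarrow> norm ((x - H x) - (z - H z)) \<le> norm (x - z) / 2"
    and r: "r \<ge> 0" and y: "norm (y - H x0) \<le> r / 2"
  shows "\<exists>z\<in>cball x0 r. H z = y"
proof -
  have "\<exists>!z\<in>cball x0 r. z - H z + y = z"
  proof (rule Banach_fix)
    show "complete (cball x0 r)" by (simp add: complete_eq_closed)
    show "cball x0 r \<noteq> {}" using r by simp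
    show "(\<lambda>z. z - H z + y) ` cball x0 r \<subseteq> cball x0 r"
    proof (rule image_subsetI)
      fix z
      assume z: "z \<in> cball x0 r"
      have "(z - H z + y) - x0 = ((z - H z) - (x0 - H x0)) + (y - H x0)" by simp
      then have "norm ((z - H z + y) - x0) \<le> norm ((z - H z) - (x0 - H x0)) + norm (y - H x0)"
        by (metis norm_triangle_ineq)
      then have "norm ((z - H z + y) - x0) \<le> norm (z - x0) / 2 + r / 2"
        using lip[OF z, of x0] r y by simp
      then show "z - H z + y \<in> cball x0 r"
        using z by (simp add: dist_norm norm_minus_commute)
    qed
    show "dist (x - H x + y) (z - H z + y) \<le> 1 / 2 * dist x z"
      if "x \<in> cball x0 r" "z \<in> cball x0 r" for x z
      using lip[OF that] by (simp add: dist_norm)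
  qed auto
  then obtain z where "z \<in> cball x0 r" "z - H z + y = z" by blast
  then show ?thesis by (intro bexI[of _ z]) auto
qed

text \<open>Since \<open>x - B x\<close> is Lipschitz with constant 1/2, the previous lemma on a
  ball of radius \<open>2 * norm y\<close> gives surjectivity, while
  \<open>norm x \<le> 2 * norm (B x)\<close> gives injectivity and the bound on the inverse.\<close>

lemma near_identity_inverse:
  fixes B :: "'a::banach \<Rightarrow>\<^sub>L 'a"
  assumes B: "norm (id_blinfun - B) \<le> 1 / 2"
  obtains B' :: "'a \<Rightarrow>\<^sub>L 'a" where "B o\<^sub>L B' = id_blinfun" "B' o\<^sub>L B = id_blinfun" "norm B' \<le> 2"
proof -
  have half: "norm (x - blinfun_apply B x) \<le> norm x / 2" for x
  proof -
    have "norm (x - blinfun_apply B x) \<le> norm (id_blinfun - B) * norm x"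
      using norm_blinfun[of "id_blinfun - B" x] by (simp add: blinfun.bilinear_simps)
    also have "\<dots> \<le> 1 / 2 * norm x" using B by (intro mult_right_mono) auto
    finally show ?thesis by simp
  qed
  have bound: "norm x \<le> norm (blinfun_apply B x) * 2" for x
    using half[of x] norm_triangle_ineq2[of x "blinfun_apply B x"] by simp
  have "\<exists>x. blinfun_apply B x = y" for y
  proof -
    have "\<exists>x\<in>cball 0 (2 * norm y). blinfun_apply B x = y"
    proof (rule perturbed_identity_attains)
      show "norm ((x - blinfun_apply B x) - (z - blinfun_apply B z)) \<le> norm (x - z) / 2" for x z
        using half[of "x - z"] by (simp add: blinfun.bilinear_simps algebra_simps)
    qed (auto simp: blinfun.bilinear_simps)
    then show ?thesis by blast
  qed
  then obtain b where b: "\<And>y. blinfun_apply B (b y) = y" by metis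
  have inj: "x = z" if "blinfun_apply B x = blinfun_apply B z" for x z
    using bound[of "x - z"] that by (simp add: blinfun.bilinear_simps)
  have bl: "bounded_linear b"
  proof (rule bounded_linear_intro[of _ 2])
    show "b (x + y) = b x + b y" for x y
      by (rule inj) (simp add: blinfun.bilinear_simps b)
    show "b (c *\<^sub>R x) = c *\<^sub>R b x" for c x
      by (rule inj) (simp add: blinfun.bilinear_simps b)
    show "norm (b x) \<le> norm x * 2" for x
      using bound[of "b x"] by (simp add: b)
  qed
  show ?thesis
  proof
    show "B o\<^sub>L Blinfun b = id_blinfun"
      by (rule blinfun_eqI) (simp add: bounded_linear_Blinfun_apply[OF bl] b)
    show "Blinfun b o\<^sub>L B = id_blinfun"
      by (rule blinfun_eqI) (simp add: bounded_linear_Blinfun_apply[OF bl] b inj)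
    show "norm (Blinfun b) \<le> 2"
      by (rule norm_blinfun_bound) (use bound[of "b _"] in \<open>auto simp: bounded_linear_Blinfun_apply[OF bl] b mult.commute\<close>)
  qed
qed

text \<open>On a small ball \<open>H'\<close> stays within 1/2 of the identity, so the two preceding
  lemmas apply to \<open>H\<close> and to each \<open>H' z\<close>. Continuity of \<open>h'\<close>
  is recorded because tangent vectors are velocities of C1 curves.\<close>

lemma local_inverse_near_identity:
  fixes H :: "'a::banach \<Rightarrow> 'a" and H' :: "'a \<Rightarrow> 'a \<Rightarrow>\<^sub>L 'a"
  assumes "open U" "x0 \<in> U" and der: "\<And>z. z \<in> U \<Longrightarrow> (H has_derivative blinfun_apply (H' z)) (at z)"
    and cont: "continuous_on U H'" and id: "H' x0 = id_blinfun"
  obtains d h h' where "d > 0" "h (H x0) = x0"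
    "\<And>y. y \<in> ball (H x0) d \<Longrightarrow> h y \<in> U" "\<And>y. y \<in> ball (H x0) d \<Longrightarrow> H (h y) = y"
    "\<And>y. y \<in> ball (H x0) d \<Longrightarrow> (h has_derivative blinfun_apply (h' y)) (at y)"
    "continuous_on (ball (H x0) d) h'" "h' (H x0) = id_blinfun"
proof -
  have "isCont H' x0"
    using cont assms(1,2) by (simp add: continuous_on_eq_continuous_at)
  then obtain r1 where r1: "r1 > 0" "\<And>z. dist z x0 < r1 \<Longrightarrow> dist (H' z) id_blinfun < 1 / 2"
    unfolding continuous_at_eps_delta id by (metis half_gt_zero zero_less_one)
  obtain r2 where r2: "r2 > 0" "cball x0 r2 \<subseteq> U"
    using assms(1,2) open_contains_cball by blast
  define r where "r = min (r1 / 2) r2"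
  have r: "r > 0" using r1 r2 by (simp add: r_def)
  have inU: "z \<in> U" if "z \<in> cball x0 r" for z
    using that r2 by (auto simp: r_def)
  have near: "norm (id_blinfun - H' z) \<le> 1 / 2" if "z \<in> cball x0 r" for z
    using r1(2)[of z] r1(1) that by (auto simp: r_def dist_norm norm_minus_commute)
  have lip: "norm ((x - H x) - (z - H z)) \<le> norm (x - z) / 2" if "x \<in> cball x0 r" "z \<in> cball x0 r" for x z
  proof -
    have "norm ((x - H x) - (z - H z)) \<le> 1 / 2 * norm (x - z)"
    proof (rule differentiable_bound[OF convex_cball[of x0 r] _ _ that])
      fix w
      assume w: "w \<in> cball x0 r"
      show "((\<lambda>x. x - H x) has_derivative blinfun_apply (id_blinfun - H' w)) (at w within cball x0 r)"
        using has_derivative_at_withinI[OF der[OF inU[OF w]]]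
        by (auto intro!: derivative_eq_intros simp: blinfun.bilinear_simps)
      show "onorm (blinfun_apply (id_blinfun - H' w)) \<le> 1 / 2"
        using near[OF w] by (simp add: norm_blinfun.rep_eq)
    qed
    then show ?thesis by simp
  qed
  \<comment> \<open>This yields injectivity of \<open>H\<close> on the ball, hence
    \<open>h (H x0) = x0\<close>, and the Lipschitz bound for \<open>h\<close>.\<close>
  have expand: "norm (x - z) \<le> 2 * norm (H x - H z)" if "x \<in> cball x0 r" "z \<in> cball x0 r" for x z
  proof -
    have "x - z = ((x - H x) - (z - H z)) + (H x - H z)" by simp
    then have "norm (x - z) \<le> norm ((x - H x) - (z - H z)) + norm (H x - H z)"
      by (metis norm_triangle_ineq)
    then show ?thesis using lip[OF that] by simp
  qed
  define d where "d = r / 2"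
  have d: "d > 0" using r by (simp add: d_def)
  have "\<exists>z. z \<in> cball x0 r \<and> H z = y" if "y \<in> ball (H x0) d" for y
    using perturbed_identity_attains[of x0 r H y, OF lip] r that
    by (auto simp: d_def dist_norm norm_minus_commute)
  then obtain h where h: "\<And>y. y \<in> ball (H x0) d \<Longrightarrow> h y \<in> cball x0 r" "\<And>y. y \<in> ball (H x0) d \<Longrightarrow> H (h y) = y"
    by metis
  have h0: "h (H x0) = x0"
    using expand[OF h(1), of "H x0" x0] h(2)[of "H x0"] d r by simp
  have hlip: "norm (h y - h z) \<le> 2 * norm (y - z)" if "y \<in> ball (H x0) d" "z \<in> ball (H x0) d" for y z
    using expand[OF h(1)[OF that(1)] h(1)[OF that(2)]] h(2) that by simp
  have hcont: "continuous_on (ball (H x0) d) h"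
    by (rule continuous_on_subset[OF lipschitz_on_continuous_on[of 2]])
      (auto simp: lipschitz_on_def dist_norm intro!: hlip)
  have "\<exists>B'. H' z o\<^sub>L B' = id_blinfun \<and> B' o\<^sub>L H' z = id_blinfun \<and> norm B' \<le> 2" if "z \<in> cball x0 r" for z
    using near_identity_inverse[OF near[OF that]] by metis
  then obtain J where J: "\<And>z. z \<in> cball x0 r \<Longrightarrow> H' z o\<^sub>L J z = id_blinfun"
    "\<And>z. z \<in> cball x0 r \<Longrightarrow> J z o\<^sub>L H' z = id_blinfun" "\<And>z. z \<in> cball x0 r \<Longrightarrow> norm (J z) \<le> 2"
    by metis
  have HJ: "blinfun_apply (H' z) (blinfun_apply (J z) w) = w"
    and JH: "blinfun_apply (J z) (blinfun_apply (H' z) w) = w" if "z \<in> cball x0 r" for z w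
    using J(1,2)[OF that] by (metis blinfun_apply_blinfun_compose blinfun_apply_id_blinfun id_apply)+
  have Jlip: "norm (J a - J b) \<le> 4 * norm (H' b - H' a)" if "a \<in> cball x0 r" "b \<in> cball x0 r" for a b
  proof -
    \<comment> \<open>The resolvent identity; the norm bound 2 on both inverses produces the factor
      4.\<close>
    have "J a - J b = J a o\<^sub>L (H' b - H' a) o\<^sub>L J b"
    proof (rule blinfun_eqI)
      fix x
      show "blinfun_apply (J a - J b) x = blinfun_apply (J a o\<^sub>L (H' b - H' a) o\<^sub>L J b) x"
        by (simp add: blinfun.bilinear_simps HJ[OF that(2)] JH[OF that(1)])
    qed
    then have "norm (J a - J b) \<le> norm (J a o\<^sub>L (H' b - H' a)) * norm (J b)"
      by (simp add: norm_blinfun_compose)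
    also have "\<dots> \<le> norm (J a) * norm (H' b - H' a) * norm (J b)"
      by (intro mult_right_mono norm_blinfun_compose norm_ge_zero)
    also have "\<dots> \<le> 2 * norm (H' b - H' a) * 2"
      using J(3) that by (intro mult_mono) auto
    finally show ?thesis by simp
  qed
  show ?thesis
  proof (rule that[of d h "\<lambda>y. J (h y)"])
    show "h y \<in> U" if "y \<in> ball (H x0) d" for y
      using inU h(1) that by blast
    show "(h has_derivative blinfun_apply (J (h y))) (at y)" if y: "y \<in> ball (H x0) d" for y
    proof (rule has_derivative_inverse_basic[where T = "ball (H x0) d"])
      show "(H has_derivative blinfun_apply (H' (h y))) (at (h y))"
        using der inU h(1) y by blast
      show "blinfun_apply (J (h y)) \<circ> blinfun_apply (H' (h y)) = id"
        by (simp add: fun_eq_iff JH[OF h(1)[OF y]])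
      show "continuous (at y) h"
        using hcont y by (simp add: continuous_on_eq_continuous_at)
    qed (use y h(2) blinfun.bounded_linear_right in auto)
    have H'c: "continuous_on (ball (H x0) d) (\<lambda>y. H' (h y))"
      using inU h(1) by (intro continuous_on_compose2[OF cont hcont]) blast
    show "continuous_on (ball (H x0) d) (\<lambda>y. J (h y))"
      unfolding continuous_on_def
    proof
      fix y
      assume y: "y \<in> ball (H x0) d"
      have "((\<lambda>w. 4 * norm (H' (h y) - H' (h w))) \<longlongrightarrow> 4 * norm (H' (h y) - H' (h y))) (at y within ball (H x0) d)"
        using H'c y unfolding continuous_on_def by (intro tendsto_intros) auto
      then have lim: "((\<lambda>w. 4 * norm (H' (h y) - H' (h w))) \<longlongrightarrow> 0) (at y within ball (H x0) d)"
        by simp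
      have "norm (J (h w) - J (h y)) \<le> 4 * norm (H' (h y) - H' (h w))" if "w \<in> ball (H x0) d" for w
        using that y h(1) by (intro Jlip) blast+
      then have "\<forall>\<^sub>F w in at y within ball (H x0) d. norm (J (h w) - J (h y)) \<le> 4 * norm (H' (h y) - H' (h w))"
        by (simp add: eventually_at_filter)
      then have "((\<lambda>w. J (h w) - J (h y)) \<longlongrightarrow> 0) (at y within ball (H x0) d)"
        by (rule Lim_null_comparison[OF _ lim])
      then show "((\<lambda>w. J (h w)) \<longlongrightarrow> J (h y)) (at y within ball (H x0) d)"
        by (rule Lim_null[THEN iffD2])
    qed
    show "J (h (H x0)) = id_blinfun"
      using HJ[of x0] id r by (intro blinfun_eqI) (simp add: h0)
  qed (use d h0 h(2) in auto)
qed

section \<open>Tangent spaces, propagation of regularity, and the multipliers\<close>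

section \<open>Generalized regular constraints\<close>

lemma C1_on_has_derivative:
  "C1_on U g \<Longrightarrow> x \<in> U \<Longrightarrow> (g has_derivative blinfun_apply (fderiv g x)) (at x)"
  by (simp add: C1_on_def fderiv_works)

text \<open>\<open>Np\<close> is taken from the neighbourhood condition rather than from
  \<open>double_split\<close>, so that the kernel of the generalized inverse and the condition on
  nearby ranges refer to the same complement.\<close>

lemma generalized_regular_pointE:
  assumes "generalized_regular_point U g x"
  obtains Rp Np U0 where "closed_subspace Rp" "direct_sum (null_space (fderiv g x)) Rp"
    "closed_subspace Np" "direct_sum (range (blinfun_apply (fderiv g x))) Np"
    "open U0" "x \<in> U0" "U0 \<subseteq> U" "\<And>w. w \<in> U0 \<Longrightarrow> range (blinfun_apply (fderiv g w)) \<inter> Np = {0}"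
proof -
  obtain Rp where "closed_subspace Rp" "direct_sum (null_space (fderiv g x)) Rp"
    using assms unfolding generalized_regular_point_def double_split_def by (elim conjE exE)
  moreover obtain Np U0 where "closed_subspace Np" "direct_sum (range (blinfun_apply (fderiv g x))) Np"
    "open U0" "x \<in> U0" "U0 \<subseteq> U" "\<forall>w\<in>U0. range (blinfun_apply (fderiv g w)) \<inter> Np = {0}"
    using assms unfolding generalized_regular_point_def by (elim conjE exE)
  ultimately show ?thesis
    using that by simp
qed

text \<open>With \<open>T\<close> the generalized inverse of \<open>A = fderiv g x0\<close> whose kernel is \<open>Np\<close>, the map
  \<open>H z = z - T A (z - x0) + T (g z - y0)\<close> has derivative \<open>id\<close> at \<open>x0\<close>, and
  \<open>T A (H z - x0) = T (g z - y0)\<close>. Hence \<open>H\<close> flattens the level set of \<open>T \<circ> g\<close>. Along a curve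
  in that level set the velocity of \<open>g\<close> lies in \<open>Np\<close>, so it vanishes by generalized regularity.\<close>

lemma null_space_subset_tangent_space:
  fixes g :: "'a::banach \<Rightarrow> 'b::banach"
  assumes C1: "C1_on U g" and gr: "generalized_regular_point U g x0" and y0: "g x0 = y0"
  shows "null_space (fderiv g x0) \<subseteq> tangent_space (constraint_set U g y0) x0"
proof
  fix v
  assume v: "v \<in> null_space (fderiv g x0)"
  define A where "A = fderiv g x0"
  obtain Rp Np U0 where Rp: "closed_subspace Rp" "direct_sum (null_space A) Rp"
    and Np: "closed_subspace Np" "direct_sum (range (blinfun_apply A)) Np"
    and U0: "open U0" "x0 \<in> U0" "U0 \<subseteq> U" "\<And>x. x \<in> U0 \<Longrightarrow> range (blinfun_apply (fderiv g x)) \<inter> Np = {0}"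
    using gr generalized_regular_pointE unfolding A_def by metis
  obtain T where T: "\<And>y. blinfun_apply T (blinfun_apply A (blinfun_apply T y)) = blinfun_apply T y"
    "\<And>y. blinfun_apply T y = 0 \<longleftrightarrow> y \<in> Np"
    using generalized_inverse[OF Rp Np] by metis
  define H where "H z = z - blinfun_apply T (blinfun_apply A (z - x0)) + blinfun_apply T (g z - y0)" for z
  define H' where "H' z = id_blinfun - (T o\<^sub>L A) + (T o\<^sub>L fderiv g z)" for z
  have Hx0: "H x0 = x0" by (simp add: H_def y0 blinfun.bilinear_simps)
  have gd: "(g has_derivative blinfun_apply (fderiv g z)) (at z)" if "z \<in> U0" for z
    using C1_on_has_derivative[OF C1] U0(3) that by blast
  have Hd: "(H has_derivative blinfun_apply (H' z)) (at z)" if "z \<in> U0" for z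
    unfolding H_def H'_def
    by (auto intro!: derivative_eq_intros gd that blinfun.bounded_linear_right simp: blinfun.bilinear_simps)
  have "continuous_on U0 (fderiv g)"
    using C1 U0(3) continuous_on_subset unfolding C1_on_def by blast
  then have Hc: "continuous_on U0 H'"
    unfolding H'_def by (intro continuous_intros)
  \<comment> \<open>The terms \<open>T A\<close> and \<open>T g'(x0)\<close> cancel in
    \<open>H' x0\<close>, so the derivative is the identity there; \<open>h' x0 = id_blinfun\<close>
    later gives \<open>c' 0 = v\<close>.\<close>
  obtain d h h' where h: "d > 0" "h x0 = x0"
    "\<And>y. y \<in> ball x0 d \<Longrightarrow> h y \<in> U0" "\<And>y. y \<in> ball x0 d \<Longrightarrow> H (h y) = y"
    "\<And>y. y \<in> ball x0 d \<Longrightarrow> (h has_derivative blinfun_apply (h' y)) (at y)"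
    "continuous_on (ball x0 d) h'" "h' x0 = id_blinfun"
    using local_inverse_near_identity[OF U0(1,2) Hd Hc] by (auto simp: Hx0 H'_def A_def)
  \<comment> \<open>The summand 1 covers \<open>v = 0\<close>; \<open>e\<close> keeps the segment
    \<open>x0 + t v\<close> inside the ball on which \<open>h\<close> is defined.\<close>
  define e where "e = d / (norm v + 1)"
  have e: "e > 0" using h(1) by (simp add: e_def add_nonneg_pos)
  define c where "c t = h (x0 + t *\<^sub>R v)" for t :: real
  define c' where "c' t = blinfun_apply (h' (x0 + t *\<^sub>R v)) v" for t :: real
  have inb: "x0 + t *\<^sub>R v \<in> ball x0 d" if "t \<in> {-e<..<e}" for t
  proof -
    have "\<bar>t\<bar> * norm v \<le> \<bar>t\<bar> * (norm v + 1)" by (simp add: mult_left_mono)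
    also have "\<dots> < e * (norm v + 1)" using that by (intro mult_strict_right_mono) (auto simp: add_nonneg_pos)
    also have "\<dots> = d" by (simp add: e_def add_nonneg_eq_0_iff)
    finally show ?thesis by (simp add: dist_norm)
  qed
  have cU: "c t \<in> U0" if "t \<in> {-e<..<e}" for t
    using h(3)[OF inb[OF that]] by (simp add: c_def)
  have cd: "(c has_vector_derivative c' t) (at t)" if "t \<in> {-e<..<e}" for t
  proof -
    have "((\<lambda>t. h (x0 + t *\<^sub>R v)) has_derivative (\<lambda>s. blinfun_apply (h' (x0 + t *\<^sub>R v)) (s *\<^sub>R v))) (at t)"
      by (rule has_derivative_compose[where f = "\<lambda>t. x0 + t *\<^sub>R v" and g = h, OF _ h(5)[OF inb[OF that]]]) (auto intro!: derivative_eq_intros)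
    then show ?thesis
      by (simp add: has_vector_derivative_def c_def[abs_def] c'_def blinfun.bilinear_simps)
  qed
  have c'c: "continuous_on {-e<..<e} c'"
    unfolding c'_def using inb
    by (intro continuous_intros continuous_on_compose2[OF h(6)]) auto
  \<comment> \<open>As \<open>H\<close> sends \<open>c t\<close> back to \<open>x0 + t v\<close>,
    the quantity equals \<open>t T A v\<close>, which vanishes.\<close>
  have level: "blinfun_apply T (g (c t) - y0) = 0" if "t \<in> {-e<..<e}" for t
  proof -
    have "blinfun_apply T (blinfun_apply A (H (c t) - x0)) = blinfun_apply T (g (c t) - y0)"
      by (simp add: H_def blinfun.bilinear_simps T(1))
    moreover have "H (c t) - x0 = t *\<^sub>R v"
      using h(4)[OF inb[OF that]] by (simp add: c_def)
    ultimately show ?thesis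
      using v by (simp add: blinfun.bilinear_simps A_def null_space_def)
  qed
  have gcd: "((\<lambda>t. g (c t)) has_vector_derivative blinfun_apply (fderiv g (c t)) (c' t)) (at t)" if "t \<in> {-e<..<e}" for t
    using has_derivative_compose[where f = c and g = g, OF cd[OF that, unfolded has_vector_derivative_def] gd[OF cU[OF that]]]
    by (simp add: has_vector_derivative_def blinfun.bilinear_simps)
  have zero: "blinfun_apply (fderiv g (c t)) (c' t) = 0" if t: "t \<in> {-e<..<e}" for t
  proof -
    have "((\<lambda>t. blinfun_apply T (g (c t) - y0)) has_vector_derivative
        blinfun_apply T (blinfun_apply (fderiv g (c t)) (c' t))) (at t)"
      by (intro bounded_linear.has_vector_derivative[OF blinfun.bounded_linear_right])
        (auto intro!: derivative_eq_intros gcd t)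
    moreover have "((\<lambda>t. blinfun_apply T (g (c t) - y0)) has_vector_derivative 0) (at t)"
      by (rule has_vector_derivative_transform_within_open[of "\<lambda>_. 0" _ _ "{-e<..<e}"])
        (use t level in auto)
    ultimately have "blinfun_apply (fderiv g (c t)) (c' t) \<in> Np"
      using vector_derivative_unique_at T(2) by metis
    then show ?thesis
      using U0(4)[OF cU[OF t]] by blast
  qed
  have "g (c t) = y0" if t: "t \<in> {-e<..<e}" for t
  proof -
    obtain k where k: "\<And>s. s \<in> {-e<..<e} \<Longrightarrow> g (c s) = k"
    proof (rule has_vector_derivative_zero_constant[of "{-e<..<e}" "\<lambda>t. g (c t)"])
      show "((\<lambda>t. g (c t)) has_vector_derivative 0) (at s within {-e<..<e})" if "s \<in> {-e<..<e}" for s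
        using gcd[OF that] zero[OF that] has_vector_derivative_at_within by metis
    qed auto
    show ?thesis
      using k[OF t] k[of 0] e by (simp add: c_def h(2) y0)
  qed
  then have "c t \<in> constraint_set U g y0" if "t \<in> {-e<..<e}" for t
    using cU[OF that] U0(3) that by (auto simp: constraint_set_def)
  moreover have "c 0 = x0" "c' 0 = v"
    by (simp_all add: c_def c'_def h(2,7))
  ultimately show "v \<in> tangent_space (constraint_set U g y0) x0"
    unfolding tangent_space_def using e cd c'c by blast
qed

text \<open>The splitting of the null space is already part of \<open>double_split\<close>, so only
  surjectivity remains to be decided.\<close>

lemma regular_point_iff_surj:
  assumes "generalized_regular_point U g x"
  shows "regular_point U g x \<longleftrightarrow> surj (blinfun_apply (fderiv g x))"
  using assms unfolding regular_point_def generalized_regular_point_def double_split_def by blast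

text \<open>With complement \<open>{0}\<close> of the range, the generalized inverse
  \<open>T\<close> is a bounded right inverse of \<open>A\<close>. For \<open>B\<close> near
  \<open>A\<close> the operator \<open>B T\<close> is within 1/2 of the identity, hence
  invertible.\<close>

lemma open_surj_blinfun_at:
  fixes A :: "'a::banach \<Rightarrow>\<^sub>L 'b::banach"
  assumes "surj (blinfun_apply A)" and "closed_subspace M" "direct_sum (null_space A) M"
  obtains \<delta> where "\<delta> > 0" "\<And>B :: 'a \<Rightarrow>\<^sub>L 'b. norm (B - A) < \<delta> \<Longrightarrow> surj (blinfun_apply B)"
proof -
  have "closed_subspace {0 :: 'b}" "direct_sum (range (blinfun_apply A)) {0}"
    using assms(1) by (auto simp: closed_subspace_def direct_sum_def)
  then obtain T where T: "\<And>x. blinfun_apply A (blinfun_apply T (blinfun_apply A x)) = blinfun_apply A x"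
    using generalized_inverse[OF assms(2,3)] by metis
  have AT: "blinfun_apply A (blinfun_apply T y) = y" for y
    using T assms(1) by (metis surjD)
  show ?thesis
  proof (rule that[of "1 / (2 * (norm T + 1))"])
    show "1 / (2 * (norm T + 1)) > 0"
      by (intro divide_pos_pos mult_pos_pos add_nonneg_pos) auto
    fix B :: "'a \<Rightarrow>\<^sub>L 'b"
    assume B: "norm (B - A) < 1 / (2 * (norm T + 1))"
    have "id_blinfun - (B o\<^sub>L T) = (A - B) o\<^sub>L T"
      by (rule blinfun_eqI) (simp add: AT blinfun.bilinear_simps)
    then have "norm (id_blinfun - (B o\<^sub>L T)) \<le> norm (B - A) * norm T"
      by (metis norm_blinfun_compose norm_minus_commute)
    also have "\<dots> \<le> 1 / (2 * (norm T + 1)) * (norm T + 1)"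
      using B by (intro mult_mono) auto
    also have "\<dots> = 1 / 2"
      using add_nonneg_pos[OF norm_ge_zero[of T] zero_less_one] by simp
    finally obtain C where "(B o\<^sub>L T) o\<^sub>L C = id_blinfun"
      using near_identity_inverse by metis
    then show "surj (blinfun_apply B)"
      by (metis blinfun_apply_blinfun_compose blinfun_apply_id_blinfun id_apply surjI)
  qed
qed

text \<open>Regular points of \<open>S\<close> are open because surjectivity is an open condition, and closed because
  at a limit of regular points the complement \<open>Np\<close> of the range meets a full range trivially.\<close>

lemma regular_point_of_connected:
  fixes g :: "'a::banach \<Rightarrow> 'b::banach"
  assumes "open U" "C1_on U g" "generalized_regular_value U g y0"
    and con: "connected (constraint_set U g y0)"
    and "x \<in> constraint_set U g y0" "regular_point U g x"
  shows "regular_value U g y0"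
proof -
  let ?S = "constraint_set U g y0"
  let ?R = "{z \<in> ?S. regular_point U g z}"
  have gr: "generalized_regular_point U g z" if "z \<in> ?S" for z
    using assms(3) that by (simp add: generalized_regular_value_def)
  have "\<exists>W. open W \<and> z \<in> W \<and> (\<forall>w\<in>W \<inter> ?S. regular_point U g w)" if "z \<in> ?R" for z
  proof -
    have z: "regular_point U g z" "z \<in> U" using that by (auto simp: regular_point_def)
    then obtain \<delta> where \<delta>: "\<delta> > 0" "\<And>B :: 'a \<Rightarrow>\<^sub>L 'b. norm (B - fderiv g z) < \<delta> \<Longrightarrow> surj (blinfun_apply B)"
      unfolding regular_point_def using open_surj_blinfun_at by metis
    have "isCont (fderiv g) z"
      using assms(1,2) z(2) by (simp add: C1_on_def continuous_on_eq_continuous_at)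
    then obtain s where s: "s > 0" "\<And>w. dist w z < s \<Longrightarrow> norm (fderiv g w - fderiv g z) < \<delta>"
      unfolding continuous_at_eps_delta using \<delta>(1) by (metis dist_norm)
    have "regular_point U g w" if "w \<in> ball z s \<inter> ?S" for w
      using s(2)[of w] \<delta>(2) that regular_point_iff_surj[OF gr] by (auto simp: dist_commute)
    then show ?thesis
      using s(1) by (intro exI[of _ "ball z s"]) auto
  qed
  then have "\<exists>T. openin (top_of_set ?S) T \<and> z \<in> T \<and> T \<subseteq> ?R" if "z \<in> ?R" for z
    using that openin_open_Int[of _ ?S] by (metis (no_types, lifting) IntE IntI Int_commute mem_Collect_eq subsetI)
  then have op: "openin (top_of_set ?S) ?R"
    by (subst openin_subopen) blast
  have "\<exists>W. open W \<and> z \<in> W \<and> (\<forall>w\<in>W \<inter> ?S. \<not> regular_point U g w)" if "z \<in> ?S - ?R" for z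
  proof -
    have "z \<in> ?S" using that by simp
    then obtain Np U0 where Np: "direct_sum (range (blinfun_apply (fderiv g z))) Np"
      and U0: "open U0" "z \<in> U0" "\<And>w. w \<in> U0 \<Longrightarrow> range (blinfun_apply (fderiv g w)) \<inter> Np = {0}"
      using generalized_regular_pointE[OF gr] by metis
    have "\<not> surj (blinfun_apply (fderiv g w))" if "w \<in> U0" for w
    proof
      assume "surj (blinfun_apply (fderiv g w))"
      then have "Np = {0}" using U0(3)[OF that] by simp
      then have "surj (blinfun_apply (fderiv g z))"
        using Np by (simp add: direct_sum_def full_SetCompr_eq)
      then show False
        using \<open>z \<in> ?S - ?R\<close> regular_point_iff_surj[OF gr] by blast
    qed
    then show ?thesis
      using U0(1,2) regular_point_def by (intro exI[of _ U0]) blast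
  qed
  then have "\<exists>T. openin (top_of_set ?S) T \<and> z \<in> T \<and> T \<subseteq> ?S - ?R" if "z \<in> ?S - ?R" for z
    using that openin_open_Int[of _ ?S] by (metis (no_types, lifting) DiffI IntE IntI DiffD1 Int_commute mem_Collect_eq subsetI)
  then have "openin (top_of_set ?S) (?S - ?R)"
    by (subst openin_subopen) blast
  then have "closedin (top_of_set ?S) ?R"
    by (simp add: closedin_def)
  then have "?R = ?S"
    using con op assms(5,6) unfolding connected_clopen by blast
  then show ?thesis
    unfolding regular_value_def by blast
qed

text \<open>At a regular point surjectivity of the derivative determines the multiplier, so
  nonuniqueness is a statement about nonregular critical points. Connectedness of the constraint set
  makes every critical point nonregular.\<close>

theorem theorem4p2:
  fixes U :: "'a::banach set" and g :: "'a \<Rightarrow> 'b::banach" and y0 :: 'b and f :: "'a \<Rightarrow> real"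
  assumes "open U"
    and "C1_on U g"
    and "generalized_regular_value U g y0"
    and "\<not> regular_value U g y0"
    and "C1_on U f"
  shows "\<forall>x. critical_point_on f (constraint_set U g y0) x \<and>
              (connected (constraint_set U g y0) \<or> \<not> regular_point U g x) \<longrightarrow>
           (\<exists>L1 L2. lagrange_multiplier f g y0 x L1 \<and> lagrange_multiplier f g y0 x L2 \<and> L1 \<noteq> L2)"
proof (intro allI impI)
  fix x
  assume x: "critical_point_on f (constraint_set U g y0) x \<and>
    (connected (constraint_set U g y0) \<or> \<not> regular_point U g x)"
  then have xS: "x \<in> constraint_set U g y0" by (simp add: critical_point_on_def)
  then have gx: "g x = y0" by (simp add: constraint_set_def)
  have gr: "generalized_regular_point U g x"
    using assms(3) xS by (simp add: generalized_regular_value_def)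
  have "\<not> regular_point U g x"
    using x regular_point_of_connected[OF assms(1-3) _ xS] assms(4) by blast
  then have nsurj: "\<not> surj (blinfun_apply (fderiv g x))"
    using regular_point_iff_surj[OF gr] by simp
  define A where "A = fderiv g x"
  obtain Rp Np where Rp: "closed_subspace Rp" "direct_sum (null_space A) Rp"
    and Np: "closed_subspace Np" "direct_sum (range (blinfun_apply A)) Np"
    using generalized_regular_pointE[OF gr] unfolding A_def by metis
  obtain T where T: "\<And>u. blinfun_apply A (blinfun_apply T (blinfun_apply A u)) = blinfun_apply A u"
    "\<And>y. blinfun_apply T y = 0 \<longleftrightarrow> y \<in> Np"
    using generalized_inverse[OF Rp Np] by metis
  have "Np \<noteq> {0}"
    using Np(2) nsurj by (auto simp: direct_sum_def A_def full_SetCompr_eq)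
  then obtain n where n: "n \<in> Np" "n \<noteq> 0"
    using Np(1) subspace_0 unfolding closed_subspace_def by blast
  then obtain \<phi> :: "'b \<Rightarrow>\<^sub>L real" where \<phi>: "blinfun_apply \<phi> n \<noteq> 0"
    using ex_bounded_functional_nonzero by metis
  \<comment> \<open>Criticality speaks of velocities of curves in the constraint set; it reaches the
    whole null space since each null vector is such a velocity.\<close>
  have crit: "blinfun_apply (fderiv f x) u = 0" if "blinfun_apply A u = 0" for u
    using x that null_space_subset_tangent_space[OF assms(2) gr gx]
    by (auto simp: critical_point_on_def null_space_def A_def)
  \<comment> \<open>\<open>T A u - u\<close> lies in the null space of \<open>A\<close>, where the
    derivative of \<open>f\<close> vanishes.\<close>
  have fT: "blinfun_apply (fderiv f x) (blinfun_apply T (blinfun_apply A u)) = blinfun_apply (fderiv f x) u" for u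
    using crit[of "blinfun_apply T (blinfun_apply A u) - u"] T(1) by (simp add: blinfun.bilinear_simps)
  define L1 where "L1 = fderiv f x o\<^sub>L T"
  \<comment> \<open>\<open>A T\<close> is the projection onto the range along \<open>Np\<close>. The
    added functional therefore vanishes on the range, which preserves the Euler equation, and takes
    the nonzero value \<open>\<phi> n\<close> at \<open>n\<close>.\<close>
  define L2 where "L2 = L1 + (\<phi> o\<^sub>L (id_blinfun - (A o\<^sub>L T)))"
  have "lagrange_multiplier f g y0 x L1"
    unfolding lagrange_multiplier_def L1_def A_def[symmetric]
    by (auto intro!: blinfun_eqI simp: blinfun.bilinear_simps fT gx)
  moreover have "lagrange_multiplier f g y0 x L2"
    unfolding lagrange_multiplier_def L2_def L1_def A_def[symmetric]
    by (auto intro!: blinfun_eqI simp: blinfun.bilinear_simps fT gx T(1))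
  moreover have "blinfun_apply L2 n - blinfun_apply L1 n = blinfun_apply \<phi> n"
    using T(2)[of n] n(1) by (simp add: L2_def blinfun.bilinear_simps)
  then have "L1 \<noteq> L2"
    using \<phi> by auto
  ultimately show "\<exists>L1 L2. lagrange_multiplier f g y0 x L1 \<and> lagrange_multiplier f g y0 x L2 \<and> L1 \<noteq> L2"
    by blast
qed

end
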